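(* Let $0<p\le2$, $\delta\ge0$, let $q$ be prime, and let $s>0$. Let $\mathcal{C}\subseteq\mathbb{F}_q^n$ be any generalized Reed–Solomon code whose adjusted rate $R^*$ satisfies $R^*<W^{(p)}_{q,\delta}(s)^2$. Then the GS soft-decision algorithm, run on the weight vector $W_{s,\mathbf{y}}$ given by $f^{(p)}_s$ and the received word $\mathbf{y}\in\mathbb{R}_q^n$ (with a suitable tolerance $\tau>0$), list-decodes $\mathcal{C}$ up to $\ell_p$ distance $d=\delta\cdot n^{1/p}$: for every $\mathbf{y}\in\mathbb{R}_q^n$ its output contains every codeword $\mathbf{c}\in\mathcal{C}$ with $\|\mathbf{y}-\mathbf{c}\|_p\le d$. Its running time is polynomial in $n$, $q$, and $1/\big(W^{(p)}_{q,\delta}(s)-\sqrt{R^*}\big)$.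
   Context: Notation: for prime $q$ identify $\mathbb{F}_q=\mathbb{Z}_q=\mathbb{Z}/q\mathbb{Z}$; $\mathbb{R}_q=\mathbb{R}/q\mathbb{Z}$. For $x\in\mathbb{R}_q$, $\overline{x}\in[-q/2,q/2)$ is its unique representative; for $\mathbf{x}\in\mathbb{R}_q^n$, $\|\mathbf{x}\|_p=\big(\sum_i|\overline{x_i}|^p\big)^{1/p}$. GRS code: for $n\le q$, $k\ge1$, $\boldsymbol\alpha\in\mathbb{F}_q^n$ with distinct entries and $\mathbf{t}\in(\mathbb{F}_q\setminus\{0\})^n$, $\mathrm{GRS}_{q,k}(\boldsymbol\alpha,\mathbf{t})=\{(t_1g(\alpha_1),\dots,t_ng(\alpha_n)):g\in\mathbb{F}_q[x],\deg g<k\}$. It has dimension $k$ and adjusted rate $R^*=(k-1)/n$. Function: $f=f^{(p)}\colon\mathbb{R}\to[0,1]$, $f(x)=\exp(-(c_p|x|)^p)$, $c_p=2\,\Gamma(1+1/p)$; extended to $\mathbb{R}^k$ by $f(\mathbf{x})=\prod_i f(x_i)$; $f_s(\mathbf{x})=f(\mathbf{x}/s)$; $f_s(X)=\sum_{\mathbf{x}\in X}f_s(\mathbf{x})$ for countable $X$. $\mathcal{L}_q=\bigcup_{z\in\mathbb{Z}}((z,z)+q\mathbb{Z}^2)$. Define $$W^{(p)}_{q,\delta}(s)=\frac{f_s(\delta)}{\sqrt{f_s(\mathcal{L}_q)}}=\frac{\exp(-(c_p\delta/s)^p)}{\sqrt{f_s(\mathcal{L}_q)}}.$$ Weight vector of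 a received word: for $y\in\mathbb{R}_q$, $x\in\mathbb{Z}_q$, $W_{s,y}(x)=f_s(y-x)$, the sum of $f_s$ over the coset $y-x$ of $q\mathbb{Z}$; $W_{s,\mathbf{y}}=(W_{s,y_1},\dots,W_{s,y_n})\in\mathbb{R}_{\ge0}^{qn}$. Correlation: $\operatorname{corr}(W,\mathbf{c})=\langle W,[\mathbf{c}]\rangle/(\|W\|_2\sqrt n)$, where $[\mathbf{c}]\in\{0,1\}^{qn}$ is the concatenation of the indicator vectors (in $\{0,1\}^q$) of the entries $c_i$. GS (Guruswami–Sudan) soft-decision algorithm: the known deterministic algorithm that, for a GRS code $\mathcal{C}\subseteq\mathbb{F}_q^n$ of adjusted rate $R^*$, given a weight vector $W\in\mathbb{R}_{\ge0}^{qn}$ and a tolerance $\tau>0$, outputs in time $\mathrm{poly}(n,q,1/\tau)$ the set of all $\mathbf{c}\in\mathcal{C}$ with $\operatorname{corr}(W,\mathbf{c})\ge\sqrt{R^*}+\tau$. (Real weights need only be approximable from below to any needed precision in polynomial time.) *)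

theory Defs
  imports
    "HOL-Analysis.Analysis"
    "HOL-Computational_Algebra.Polynomial"
    "HOL-Computational_Algebra.Primes"
begin

text \<open>
  Conventions. Elements of \<open>\<int>/q\<int>\<close> are the naturals below \<open>q\<close>. (The modulus is not encoded in a
  type, because the running-time bounds must be uniform in \<open>q\<close>.) Elements of \<open>\<real>/q\<int>\<close> are given by
  arbitrary real representatives; everything below depends on them only modulo \<open>q\<close>.
  Vectors are lists.
\<close>

subsection \<open>The torus norm\<close>

text \<open>The unique representative of \<open>x\<close> modulo \<open>q\<close> in the half-open interval from \<open>-q/2\<close> to \<open>q/2\<close>.\<close>

definition centered :: "nat \<Rightarrow> real \<Rightarrow> real" where
  "centered q x = x - real q * of_int \<lfloor>x / real q + 1 / 2\<rfloor>"

definition lp_norm :: "real \<Rightarrow> nat \<Rightarrow> real list \<Rightarrow> real" where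
  "lp_norm p q xs = (\<Sum>x\<leftarrow>xs. \<bar>centered q x\<bar> powr p) powr (1 / p)"

definition lp_dist :: "real \<Rightarrow> nat \<Rightarrow> real list \<Rightarrow> nat list \<Rightarrow> real" where
  "lp_dist p q y c = lp_norm p q (map2 (\<lambda>v x. v - real x) y c)"


subsection \<open>Generalized Reed--Solomon codes\<close>

definition GRS_params :: "nat \<Rightarrow> nat \<Rightarrow> nat \<Rightarrow> nat list \<Rightarrow> nat list \<Rightarrow> bool" where
  "GRS_params q n k \<alpha> t \<longleftrightarrow>
     prime q \<and> 1 \<le> n \<and> n \<le> q \<and> 1 \<le> k \<and>
     length \<alpha> = n \<and> set \<alpha> \<subseteq> {..<q} \<and> distinct \<alpha> \<and>
     length t = n \<and> set t \<subseteq> {1..<q}"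

text \<open>
  Polynomials over \<open>\<int>/q\<int>\<close> are polynomials with natural coefficients below \<open>q\<close>; they are
  evaluated over the naturals and the result is reduced modulo \<open>q\<close>.
\<close>

definition GRS :: "nat \<Rightarrow> nat \<Rightarrow> nat list \<Rightarrow> nat list \<Rightarrow> nat list set" where
  "GRS q k \<alpha> t =
     {map2 (\<lambda>b a. (b * poly g a) mod q) t \<alpha> | g :: nat poly.
        degree g < k \<and> (\<forall>i. coeff g i < q)}"

definition adjusted_rate :: "nat \<Rightarrow> nat \<Rightarrow> real" where
  "adjusted_rate n k = (real k - 1) / real n"


subsection \<open>The weight function\<close>

definition c_const :: "real \<Rightarrow> real" where
  "c_const p = 2 * Gamma (1 + 1 / p)"

definition f_fun :: "real \<Rightarrow> real \<Rightarrow> real" where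
  "f_fun p x = exp (- ((c_const p * \<bar>x\<bar>) powr p))"

text \<open>The sums \<open>f\<^sub>s(X)\<close> for sets \<open>X\<close> of reals and of points of the plane.\<close>

definition f_sum :: "real \<Rightarrow> real \<Rightarrow> real set \<Rightarrow> real" where
  "f_sum p s X = (\<Sum>\<^sub>\<infinity>x\<in>X. f_fun p (x / s))"

definition f_sum2 :: "real \<Rightarrow> real \<Rightarrow> (real \<times> real) set \<Rightarrow> real" where
  "f_sum2 p s X = (\<Sum>\<^sub>\<infinity>(x, y)\<in>X. f_fun p (x / s) * f_fun p (y / s))"

definition L_lattice :: "nat \<Rightarrow> (real \<times> real) set" where
  "L_lattice q =
     (\<Union>z::int. {(of_int z + real q * of_int a, of_int z + real q * of_int b) | a b :: int. True})"

definition W_bound :: "real \<Rightarrow> nat \<Rightarrow> real \<Rightarrow> real \<Rightarrow> real" where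
  "W_bound p q \<delta> s = f_fun p (\<delta> / s) / sqrt (f_sum2 p s (L_lattice q))"


subsection \<open>Weight vectors and correlation\<close>

text \<open>Vectors in \<open>\<real>\<close> to the power \<open>q n\<close> are the concatenation of \<open>n\<close> blocks of length \<open>q\<close>.\<close>

definition weights :: "real \<Rightarrow> real \<Rightarrow> nat \<Rightarrow> real list \<Rightarrow> real list" where
  "weights p s q ys =
     concat (map (\<lambda>y. map (\<lambda>x. f_sum p s {y - real x + real q * of_int z | z :: int. True}) [0..<q]) ys)"

definition indicator_vec :: "nat \<Rightarrow> nat list \<Rightarrow> real list" where
  "indicator_vec q c = concat (map (\<lambda>a. map (\<lambda>x. if x = a then 1 else 0) [0..<q]) c)"

definition inner_list :: "real list \<Rightarrow> real list \<Rightarrow> real" where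
  "inner_list u v = sum_list (map2 (*) u v)"

definition l2_norm :: "real list \<Rightarrow> real" where
  "l2_norm u = sqrt (\<Sum>x\<leftarrow>u. x\<^sup>2)"

definition corr :: "nat \<Rightarrow> real list \<Rightarrow> nat list \<Rightarrow> real" where
  "corr q w c = inner_list w (indicator_vec q c) / (l2_norm w * sqrt (real (length c)))"


subsection \<open>Deterministic algorithms and the soft-decision decoder\<close>

text \<open>
  A deterministic algorithm is a computational method in the sense of Knuth: a state space with
  an input map, a transition function, a set of halting states and an output map. The running
  time is the number of transitions made before the first halting state. No particular machine is
  fixed; every concrete deterministic model with its own elementary steps, such as a random access
  machine with real registers, is an instance.
\<close>

record ('i, 's, 'o) algorithm =
  init :: "'i \<Rightarrow> 's"
  step :: "'s \<Rightarrow> 's"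
  halted :: "'s \<Rightarrow> bool"
  result :: "'s \<Rightarrow> 'o"

text \<open>On input \<open>x\<close>, \<open>A\<close> halts after exactly \<open>m\<close> steps with output \<open>r\<close>.\<close>

definition runs :: "('i, 's, 'o) algorithm \<Rightarrow> 'i \<Rightarrow> 'o \<Rightarrow> nat \<Rightarrow> bool" where
  "runs A x r m \<longleftrightarrow>
     (\<forall>j<m. \<not> halted A ((step A ^^ j) (init A x))) \<and>
     halted A ((step A ^^ m) (init A x)) \<and>
     r = result A ((step A ^^ m) (init A x))"

text \<open>
  Input: the description \<open>(q, k, \<alpha>, t)\<close> of the code, the weight vector and the tolerance.
  Output: a list of words.
\<close>

type_synonym GS_input = "nat \<times> nat \<times> nat list \<times> nat list \<times> real list \<times> real"

text \<open>
  The specification of the Guruswami--Sudan soft-decision algorithm. As all arguments are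
  nonnegative and \<open>n + q \<ge> 1\<close>, being polynomially bounded in \<open>n\<close>, \<open>q\<close>, \<open>1/\<tau>\<close> is the same as being
  bounded by a constant times a fixed power of their sum. The constants depend on the algorithm only.
\<close>

definition GS_soft_decoder :: "(GS_input, 's, nat list list) algorithm \<Rightarrow> bool" where
  "GS_soft_decoder A \<longleftrightarrow>
     (\<exists>(C::real) (e::nat). \<forall>q n k \<alpha> t w \<tau>.
        GRS_params q n k \<alpha> t \<and> length w = q * n \<and> (\<forall>x\<in>set w. 0 \<le> x) \<and> 0 < \<tau> \<longrightarrow>
        (\<exists>out m. runs A (q, k, \<alpha>, t, w, \<tau>) out m \<and>
           set out = {c \<in> GRS q k \<alpha> t. corr q w c \<ge> sqrt (adjusted_rate n k) + \<tau>} \<and>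
           real m \<le> C * (real n + real q + 1 / \<tau>) ^ e))"

end

theory Submission imports Defs begin

text \<open>
  With \<open>\<tau> = W - sqrt R\<^sup>*\<close> it suffices that every codeword within distance \<open>d\<close> of the received word
  has correlation at least \<open>W\<close> with the weight vector.

  The numerator of the correlation is bounded below by convexity of \<open>exp\<close>. For the denominator,
  the squared norm of the block of weights of a received symbol \<open>y\<close> is the sum of
  \<open>f\<^sub>s\<close> over the translate of the lattice \<open>\<L>\<^sub>q\<close> by \<open>(y, y)\<close>, and for \<open>p \<le> 2\<close> no translate has a
  larger sum than the lattice itself. This is because \<open>f\<close> is positive definite: by Schoenberg's
  criterion, \<open>exp (- N)\<close> is positive definite if \<open>N\<close> is conditionally negative definite, and
  \<open>|x - y|\<close> to the power \<open>p\<close> is a mixture of the kernels \<open>1 - exp (- t (x - y)\<^sup>2)\<close>, which are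
  conditionally negative definite by the same criterion. Testing positive definiteness on a large
  box \<open>Q\<close> of lattice points, with weight \<open>-1\<close>, and its translate \<open>Q + (y, y)\<close>, with weight \<open>1\<close>,
  and dividing by the size of \<open>Q\<close> compares the two lattice sums without Poisson summation.

  If the sum over \<open>\<L>\<^sub>q\<close> diverged, \<open>infsum\<close> would be \<open>0\<close> and hence \<open>W\<close> too, against the
  assumption on the rate; so all summability follows from that assumption.
\<close>

section \<open>Positive definite kernels\<close>

text \<open>Symmetry is a separate clause because a real quadratic form does not see the
  antisymmetric part of a kernel. For infinite \<open>S\<close> the sums are 0 by convention, so the
  form carries information only on finite sets.\<close>

definition psd_on :: "'a set \<Rightarrow> ('a \<Rightarrow> 'a \<Rightarrow> real) \<Rightarrow> bool" where
  "psd_on S K \<longleftrightarrow> (\<forall>x\<in>S. \<forall>y\<in>S. K x y = K y x) \<and>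
     (\<forall>c. 0 \<le> (\<Sum>x\<in>S. \<Sum>y\<in>S. c x * c y * K x y))"

definition cnd_on :: "'a set \<Rightarrow> ('a \<Rightarrow> 'a \<Rightarrow> real) \<Rightarrow> bool" where
  "cnd_on S N \<longleftrightarrow> (\<forall>x\<in>S. \<forall>y\<in>S. N x y = N y x) \<and>
     (\<forall>c. (\<Sum>x\<in>S. c x) = 0 \<longrightarrow> (\<Sum>x\<in>S. \<Sum>y\<in>S. c x * c y * N x y) \<le> 0)"

section \<open>Closure properties of positive semidefinite kernels\<close>

lemma psd_onD: "psd_on S K \<Longrightarrow> 0 \<le> (\<Sum>x\<in>S. \<Sum>y\<in>S. c x * c y * K x y)"
  by (simp add: psd_on_def)

lemma psd_on_sym: "psd_on S K \<Longrightarrow> x \<in> S \<Longrightarrow> y \<in> S \<Longrightarrow> K x y = K y x"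
  by (simp add: psd_on_def)

lemma psd_on_cong:
  assumes "psd_on S K" "\<And>x y. x \<in> S \<Longrightarrow> y \<in> S \<Longrightarrow> L x y = K x y"
  shows "psd_on S L"
proof -
  have "(\<Sum>x\<in>S. \<Sum>y\<in>S. c x * c y * L x y) = (\<Sum>x\<in>S. \<Sum>y\<in>S. c x * c y * K x y)" for c
    by (intro sum.cong refl) (simp add: assms(2))
  then show ?thesis using assms by (simp add: psd_on_def)
qed

lemma sum_rank_one:
  fixes c g :: "'a \<Rightarrow> real"
  shows "(\<Sum>x\<in>S. \<Sum>y\<in>S. c x * c y * (g x * g y)) = (\<Sum>x\<in>S. c x * g x)\<^sup>2"
proof -
  have "(\<Sum>x\<in>S. \<Sum>y\<in>S. c x * c y * (g x * g y)) = (\<Sum>x\<in>S. \<Sum>y\<in>S. (c x * g x) * (c y * g y))"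
    by (intro sum.cong refl) (simp add: algebra_simps)
  then show ?thesis by (simp add: power2_eq_square sum_product)
qed

lemma psd_on_const: "0 \<le> a \<Longrightarrow> psd_on S (\<lambda>x y. a)"
proof -
  assume a: "0 \<le> a"
  have "(\<Sum>x\<in>S. \<Sum>y\<in>S. c x * c y * a) = a * (\<Sum>x\<in>S. c x)\<^sup>2" for c
    by (simp add: power2_eq_square sum_product sum_distrib_left algebra_simps)
  then show ?thesis using a by (simp add: psd_on_def)
qed

lemma psd_on_add:
  assumes "psd_on S K" "psd_on S L"
  shows "psd_on S (\<lambda>x y. K x y + L x y)"
proof -
  have "(\<Sum>x\<in>S. \<Sum>y\<in>S. c x * c y * (K x y + L x y)) =
      (\<Sum>x\<in>S. \<Sum>y\<in>S. c x * c y * K x y) + (\<Sum>x\<in>S. \<Sum>y\<in>S. c x * c y * L x y)" for c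
    by (simp add: distrib_left sum.distrib)
  then show ?thesis using assms by (simp add: psd_on_def)
qed

lemma psd_on_weight:
  assumes "psd_on S K"
  shows "psd_on S (\<lambda>x y. a x * a y * K x y)"
proof -
  have "(\<Sum>x\<in>S. \<Sum>y\<in>S. c x * c y * (a x * a y * K x y)) =
      (\<Sum>x\<in>S. \<Sum>y\<in>S. (c x * a x) * (c y * a y) * K x y)" for c
    by (intro sum.cong refl) (simp add: algebra_simps)
  also have "\<dots> c \<ge> 0" for c using psd_onD[OF assms, of "\<lambda>x. c x * a x"] .
  finally show ?thesis using assms by (simp add: psd_on_def)
qed

lemma psd_on_limit:
  assumes "\<And>n. psd_on S (K n)" "\<And>x y. x \<in> S \<Longrightarrow> y \<in> S \<Longrightarrow> (\<lambda>n. K n x y) \<longlonglongrightarrow> L x y"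
  shows "psd_on S L"
  unfolding psd_on_def
proof (intro conjI ballI allI)
  fix x y assume xy: "x \<in> S" "y \<in> S"
  have "(\<lambda>n. K n x y) = (\<lambda>n. K n y x)"
    using psd_on_sym[OF assms(1)] xy by blast
  then show "L x y = L y x"
    using assms(2)[OF xy] assms(2)[OF xy(2,1)] LIMSEQ_unique by metis
next
  fix c
  have "(\<lambda>n. \<Sum>x\<in>S. \<Sum>y\<in>S. c x * c y * K n x y) \<longlonglongrightarrow> (\<Sum>x\<in>S. \<Sum>y\<in>S. c x * c y * L x y)"
    by (intro tendsto_sum tendsto_mult tendsto_const assms(2))
  then show "0 \<le> (\<Sum>x\<in>S. \<Sum>y\<in>S. c x * c y * L x y)"
    by (rule LIMSEQ_le_const) (auto intro: psd_onD assms(1))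
qed

section \<open>Gram representations, Schur products and exponentials\<close>

lemma psd_on_insertD:
  assumes "finite S" "a \<notin> S" and K: "psd_on (insert a S) K"
  shows "0 \<le> u\<^sup>2 * K a a + 2 * u * (\<Sum>x\<in>S. c x * K a x) + (\<Sum>x\<in>S. \<Sum>y\<in>S. c x * c y * K x y)"
proof -
  \<comment> \<open>The test vector is \<open>c\<close> on \<open>S\<close> with the free entry
    \<open>u\<close> at \<open>a\<close>; the result is a quadratic polynomial in
    \<open>u\<close>.\<close>
  let ?c = "\<lambda>x. if x = a then u else c x"
  have eq: "?c x = c x" if "x \<in> S" for x using that assms by auto
  have "(\<Sum>x\<in>insert a S. \<Sum>y\<in>insert a S. ?c x * ?c y * K x y)
      = u * u * K a a + (\<Sum>y\<in>S. u * c y * K a y) + (\<Sum>x\<in>S. c x * u * K x a + (\<Sum>y\<in>S. c x * c y * K x y))"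
    using assms(1,2) by (simp add: eq cong: sum.cong)
  also have "(\<Sum>x\<in>S. c x * u * K x a + (\<Sum>y\<in>S. c x * c y * K x y))
      = (\<Sum>x\<in>S. u * c x * K a x) + (\<Sum>x\<in>S. \<Sum>y\<in>S. c x * c y * K x y)"
    by (subst sum.distrib, intro arg_cong2[where f="(+)"] sum.cong refl)
       (use psd_on_sym[OF K] in auto)
  finally show ?thesis
    using psd_onD[OF K, of ?c] by (simp add: power2_eq_square sum_distrib_left algebra_simps)
qed

text \<open>Cholesky factorization, one pivot \<open>a\<close> per induction step: subtracting the
  rank-one kernel \<open>r x * r y\<close> clears the row of \<open>a\<close>, and what remains on
  \<open>S\<close>, the Schur complement, is again positive semidefinite.\<close>

lemma psd_on_gram:
  assumes "finite S" "psd_on S K"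
  shows "\<exists>(M::nat) g. \<forall>x\<in>S. \<forall>y\<in>S. K x y = (\<Sum>m<M. g m x * g m y)"
  using assms
proof (induction S arbitrary: K rule: finite_induct)
  case empty
  then show ?case by auto
next
  case (insert a S)
  note ins = psd_on_insertD[OF insert.hyps insert.prems]
  note sym = psd_on_sym[OF insert.prems]
  have Kaa: "0 \<le> K a a" using ins[of 1 "\<lambda>_. 0"] by simp
  \<comment> \<open>If the pivot vanishes, the polynomial in \<open>u\<close> is affine; being
    nonnegative for all \<open>u\<close>, it must have slope zero.\<close>
  have row0: "K a x = 0" if "K a a = 0" "x \<in> S" for x
  proof (rule ccontr)
    assume nz: "K a x \<noteq> 0"
    let ?c = "\<lambda>y. if y = x then K a x else 0"
    have 1: "(\<Sum>y\<in>S. ?c y * K a y) = (K a x)\<^sup>2"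
      using insert.hyps that by (simp add: power2_eq_square if_distrib[of "\<lambda>z. z * _"] sum.delta cong: if_cong)
    have 2: "0 \<le> 2 * u * (K a x)\<^sup>2 + (\<Sum>x\<in>S. \<Sum>y\<in>S. ?c x * ?c y * K x y)" for u
      using ins[of u ?c] that(1) unfolding 1 by simp
    define Q where "Q = (\<Sum>x\<in>S. \<Sum>y\<in>S. ?c x * ?c y * K x y)"
    \<comment> \<open>This \<open>u\<close> makes the right-hand side
      \<open>Q - 2 * (\<bar>Q\<bar> + 1)\<close>, which is negative.\<close>
    have "0 \<le> 2 * (- (\<bar>Q\<bar> + 1) / (K a x)\<^sup>2) * (K a x)\<^sup>2 + Q" using 2 unfolding Q_def .
    then show False using nz by simp
  qed
  \<comment> \<open>For a zero pivot, division by zero gives \<open>r = 0\<close>, which is the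
    correct value by \<open>row0\<close>.\<close>
  define r where "r = (\<lambda>x. K a x / sqrt (K a a))"
  have raa: "r a * r a = K a a" using Kaa by (simp add: r_def)
  have ra: "r a * r x = K a x" if "x \<in> S" for x
    using Kaa row0[OF _ that] by (cases "K a a = 0") (auto simp: r_def)
  have "psd_on S (\<lambda>x y. K x y - r x * r y)"
    unfolding psd_on_def
  proof (intro conjI ballI allI)
    fix x y assume "x \<in> S" "y \<in> S"
    then show "K x y - r x * r y = K y x - r y * r x" using sym by simp
  next
    fix c
    define s where "s = (\<Sum>x\<in>S. c x * K a x)"
    have "(\<Sum>x\<in>S. c x * r x) = s / sqrt (K a a)"
      by (simp add: s_def r_def sum_divide_distrib)
    then have sq: "(\<Sum>x\<in>S. c x * r x)\<^sup>2 = s\<^sup>2 / K a a"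
      using Kaa by (simp add: power_divide)
    \<comment> \<open>For a nonzero pivot, \<open>u = - s / K a a\<close> minimizes the quadratic
      polynomial in \<open>u\<close>.\<close>
    have "0 \<le> (s / K a a)\<^sup>2 * K a a - 2 * (s / K a a) * s + (\<Sum>x\<in>S. \<Sum>y\<in>S. c x * c y * K x y)"
      using ins[of "- (s / K a a)" c] by (simp add: s_def)
    also have "(s / K a a)\<^sup>2 * K a a - 2 * (s / K a a) * s = - (s\<^sup>2 / K a a)"
      by (cases "K a a = 0") (auto simp: field_simps power2_eq_square)
    finally have "s\<^sup>2 / K a a \<le> (\<Sum>x\<in>S. \<Sum>y\<in>S. c x * c y * K x y)" by simp
    moreover have "(\<Sum>x\<in>S. \<Sum>y\<in>S. c x * c y * (K x y - r x * r y))
        = (\<Sum>x\<in>S. \<Sum>y\<in>S. c x * c y * K x y) - (\<Sum>x\<in>S. c x * r x)\<^sup>2"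
      unfolding sum_rank_one[symmetric] by (simp add: right_diff_distrib sum_subtractf)
    ultimately show "0 \<le> (\<Sum>x\<in>S. \<Sum>y\<in>S. c x * c y * (K x y - r x * r y))" using sq by simp
  qed
  from insert.IH[OF this] obtain M :: nat and g where
    g: "\<forall>x\<in>S. \<forall>y\<in>S. K x y - r x * r y = (\<Sum>m<M. g m x * g m y)" by blast
  \<comment> \<open>The old vectors are extended by 0 at \<open>a\<close>, and \<open>r\<close>
    becomes vector number \<open>M\<close>.\<close>
  define g' where "g' = (\<lambda>m x. if m = M then r x else if x = a then 0 else g m x)"
  have "K x y = (\<Sum>m<Suc M. g' m x * g' m y)" if "x \<in> insert a S" "y \<in> insert a S" for x y
  proof -
    have "(\<Sum>m<Suc M. g' m x * g' m y) = (if x = a \<or> y = a then 0 else \<Sum>m<M. g m x * g m y) + r x * r y"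
    proof -
      have "(\<Sum>m<M. g' m x * g' m y) = (\<Sum>m<M. if x = a \<or> y = a then 0 else g m x * g m y)"
        by (intro sum.cong refl) (simp add: g'_def)
      then show ?thesis by (cases "x = a \<or> y = a") (simp_all add: g'_def)
    qed
    also have "\<dots> = K x y"
    proof (cases "x = a \<or> y = a")
      case True
      then show ?thesis using that raa ra[of x] ra[of y] sym[of x a] by (auto simp: mult.commute)
    next
      case False
      then have "K x y - r x * r y = (\<Sum>m<M. g m x * g m y)" using that g by blast
      then show ?thesis using False by simp
    qed
    finally show ?thesis by simp
  qed
  then show ?case by blast
qed

text \<open>Schur product theorem: with \<open>K\<close> in Gram form, the product is a sum of
  kernels \<open>g m x * g m y * L x y\<close>, each a reweighting of \<open>L\<close>.\<close>

lemma psd_on_mult: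
  assumes "finite S" "psd_on S K" "psd_on S L"
  shows "psd_on S (\<lambda>x y. K x y * L x y)"
proof -
  obtain M :: nat and g where g: "\<forall>x\<in>S. \<forall>y\<in>S. K x y = (\<Sum>m<M. g m x * g m y)"
    using psd_on_gram[OF assms(1,2)] by blast
  have "psd_on S (\<lambda>x y. \<Sum>m<N. g m x * g m y * L x y)" for N :: nat
  proof (induction N)
    case (Suc N)
    show ?case using psd_on_add[OF Suc psd_on_weight[OF assms(3), of "g N"]] by simp
  qed (simp add: psd_on_const)
  then show ?thesis
    by (rule psd_on_cong) (simp add: g sum_distrib_right)
qed

text \<open>The partial sums of the exponential series have nonnegative coefficients and positive
  semidefinite powers, and the cone is closed under pointwise limits.\<close>

lemma psd_on_exp:
  assumes "finite S" "psd_on S K"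
  shows "psd_on S (\<lambda>x y. exp (K x y))"
proof -
  have pw: "psd_on S (\<lambda>x y. K x y ^ n)" for n
    by (induction n) (auto intro: psd_on_const psd_on_mult assms)
  have "psd_on S (\<lambda>x y. \<Sum>k<n. K x y ^ k /\<^sub>R fact k)" for n
  proof (induction n)
    case (Suc n)
    have "psd_on S (\<lambda>x y. inverse (fact n) * K x y ^ n)"
      by (intro psd_on_mult psd_on_const pw assms) simp
    then show ?case using Suc by (simp add: psd_on_add)
  qed (simp add: psd_on_const)
  then show ?thesis
    by (rule psd_on_limit[where K = "\<lambda>n x y. \<Sum>k<n. K x y ^ k /\<^sub>R fact k"])
      (use exp_converges[where 'a=real] in \<open>simp_all add: sums_def\<close>)
qed

text \<open>Schoenberg's criterion. Relative to a base point \<open>o'\<close>, the kernel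
  \<open>K\<close> below is positive semidefinite, and \<open>exp (- N x y)\<close> is a positive
  constant times a rank-one kernel times \<open>exp (K x y)\<close>.\<close>

lemma psd_on_exp_cnd:
  assumes fin: "finite S" and N: "cnd_on S N"
  shows "psd_on S (\<lambda>x y. exp (- N x y))"
proof (cases "S = {}")
  case True
  then show ?thesis by (simp add: psd_on_def)
next
  case False
  then obtain o' where o: "o' \<in> S" by blast
  have sym: "N x y = N y x" if "x \<in> S" "y \<in> S" for x y using N that by (simp add: cnd_on_def)
  define K where "K = (\<lambda>x y. N x o' + N y o' - N x y - N o' o')"
  have "psd_on S K"
    unfolding psd_on_def
  proof (intro conjI ballI allI)
    fix x y assume "x \<in> S" "y \<in> S"
    then show "K x y = K y x" using sym by (simp add: K_def)
  next
    fix c :: "'a \<Rightarrow> real"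
    define t where "t = (\<Sum>x\<in>S. c x)"
    define u where "u = (\<Sum>x\<in>S. c x * N x o')"
    \<comment> \<open>Moving the total mass \<open>t\<close> of \<open>c\<close> to the base point
      with opposite sign gives weights of sum zero. The form of \<open>K\<close> at \<open>c\<close>
      is minus the form of \<open>N\<close> at \<open>c'\<close>.\<close>
    define c' where "c' = (\<lambda>x. c x - (if x = o' then t else 0))"
    have dl: "(\<Sum>x\<in>S. (if x = o' then t else 0) * h x) = t * h o'" for h :: "'a \<Rightarrow> real"
      using fin o by (simp add: if_distrib[of "\<lambda>z. z * _"] sum.delta cong: if_cong)
    have "(\<Sum>x\<in>S. c' x) = 0" using fin o by (simp add: c'_def sum_subtractf t_def)
    then have "(\<Sum>x\<in>S. \<Sum>y\<in>S. c' x * c' y * N x y) \<le> 0" using N by (simp add: cnd_on_def)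
    moreover have "(\<Sum>x\<in>S. \<Sum>y\<in>S. c' x * c' y * N x y) =
        (\<Sum>x\<in>S. \<Sum>y\<in>S. c x * c y * N x y) - 2 * t * u + t\<^sup>2 * N o' o'"
    proof -
      have "(\<Sum>y\<in>S. c' y * N x y) = (\<Sum>y\<in>S. c y * N x y) - t * N x o'" for x
        unfolding c'_def left_diff_distrib sum_subtractf dl ..
      then have "(\<Sum>x\<in>S. \<Sum>y\<in>S. c' x * c' y * N x y) = (\<Sum>x\<in>S. c' x * ((\<Sum>y\<in>S. c y * N x y) - t * N x o'))"
        by (simp add: mult.assoc flip: sum_distrib_left)
      also have "\<dots> = (\<Sum>x\<in>S. c x * ((\<Sum>y\<in>S. c y * N x y) - t * N x o')) - t * ((\<Sum>y\<in>S. c y * N o' y) - t * N o' o')"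
        unfolding c'_def left_diff_distrib sum_subtractf dl ..
      also have "(\<Sum>y\<in>S. c y * N o' y) = u"
        unfolding u_def by (intro sum.cong refl) (simp add: sym o)
      also have "(\<Sum>x\<in>S. c x * ((\<Sum>y\<in>S. c y * N x y) - t * N x o')) = (\<Sum>x\<in>S. \<Sum>y\<in>S. c x * c y * N x y) - t * u"
        by (simp add: right_diff_distrib sum_subtractf sum_distrib_left u_def algebra_simps)
      finally show ?thesis by (simp add: algebra_simps power2_eq_square)
    qed
    moreover have "(\<Sum>x\<in>S. \<Sum>y\<in>S. c x * c y * K x y) =
        2 * t * u - (\<Sum>x\<in>S. \<Sum>y\<in>S. c x * c y * N x y) - t\<^sup>2 * N o' o'"
    proof -
      have "(\<Sum>x\<in>S. \<Sum>y\<in>S. c x * c y * K x y) =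
          (\<Sum>x\<in>S. \<Sum>y\<in>S. (c x * N x o') * c y) + (\<Sum>x\<in>S. \<Sum>y\<in>S. c x * (c y * N y o'))
          - (\<Sum>x\<in>S. \<Sum>y\<in>S. c x * c y * N x y) - (\<Sum>x\<in>S. \<Sum>y\<in>S. c x * c y) * N o' o'"
        unfolding sum_distrib_right sum.distrib[symmetric] sum_subtractf[symmetric]
        by (intro sum.cong refl) (simp add: K_def algebra_simps)
      then show ?thesis by (simp add: flip: sum_product t_def u_def) (simp add: power2_eq_square)
    qed
    ultimately show "0 \<le> (\<Sum>x\<in>S. \<Sum>y\<in>S. c x * c y * K x y)" by simp
  qed
  then have "psd_on S (\<lambda>x y. exp (N o' o') * ((exp (- N x o') * exp (- N y o')) * exp (K x y)))"
    by (intro psd_on_mult[OF fin] psd_on_const psd_on_weight psd_on_exp fin) auto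
  then show ?thesis
    by (rule psd_on_cong) (simp add: K_def flip: exp_add)
qed

section \<open>Basic conditionally negative definite kernels\<close>

lemma cnd_on_scale:
  assumes "cnd_on S K" "0 \<le> b"
  shows "cnd_on S (\<lambda>x y. b * K x y)"
  unfolding cnd_on_def
proof (intro conjI ballI allI impI)
  fix c :: "'a \<Rightarrow> real" assume "sum c S = 0"
  then have "(\<Sum>x\<in>S. \<Sum>y\<in>S. c x * c y * K x y) \<le> 0"
    using assms by (auto simp: cnd_on_def)
  then have "b * (\<Sum>x\<in>S. \<Sum>y\<in>S. c x * c y * K x y) \<le> 0" using assms by (simp add: mult_nonneg_nonpos)
  then show "(\<Sum>x\<in>S. \<Sum>y\<in>S. c x * c y * (b * K x y)) \<le> 0"
    by (simp add: sum_distrib_left algebra_simps)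
qed (use assms in \<open>auto simp: cnd_on_def\<close>)

text \<open>When the square is expanded, the two pure terms vanish against weights of sum zero, and
  the mixed term leaves minus twice a square.\<close>

lemma cnd_on_square:
  fixes h :: "'a \<Rightarrow> real"
  shows "cnd_on S (\<lambda>x y. (h x - h y)\<^sup>2)"
  unfolding cnd_on_def
proof (intro conjI ballI allI impI)
  fix c :: "'a \<Rightarrow> real" assume 0: "sum c S = 0"
  have "(\<Sum>x\<in>S. \<Sum>y\<in>S. c x * c y * (h x - h y)\<^sup>2) =
      (\<Sum>x\<in>S. \<Sum>y\<in>S. (c x * (h x)\<^sup>2) * c y) + (\<Sum>x\<in>S. \<Sum>y\<in>S. c x * (c y * (h y)\<^sup>2))
      - 2 * (\<Sum>x\<in>S. \<Sum>y\<in>S. c x * c y * (h x * h y))"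
    by (simp add: sum_distrib_left flip: sum.distrib sum_subtractf)
       (intro sum.cong refl, simp add: algebra_simps power2_eq_square)
  also have "\<dots> = - 2 * (\<Sum>x\<in>S. c x * h x)\<^sup>2"
    unfolding sum_rank_one by (simp add: 0 flip: sum_product)
  finally show "(\<Sum>x\<in>S. \<Sum>y\<in>S. c x * c y * (h x - h y)\<^sup>2) \<le> 0" by simp
qed (simp add: power2_commute)

section \<open>Powers of the distance\<close>

text \<open>Near 0 the bound \<open>1 - exp (- t) \<le> t\<close> leaves
  \<open>t powr (- a)\<close>, integrable since \<open>a < 1\<close>; beyond 1 the bound by 1 leaves
  \<open>t powr (- 1 - a)\<close>, integrable since \<open>a > 0\<close>.\<close>

lemma integrable_bernstein_density:
  fixes a :: real
  assumes "0 < a" "a < 1"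
  shows "integrable lborel (\<lambda>t. indicator {0<..} t * ((1 - exp (- t)) * t powr (- 1 - a)))" (is "integrable _ ?g")
proof -
  have bd: "\<bar>?g t\<bar> \<le> indicator {0<..1} t * t powr (- a) + indicator {1..} t * t powr (- 1 - a)" for t
  proof -
    have "(1 - exp (- t)) * t powr (- 1 - a) \<le> t * t powr (- 1 - a)" if "0 < t"
      using exp_ge_add_one_self[of "- t"] by (intro mult_right_mono) (auto simp del: exp_ge_add_one_self)
    moreover have "t * t powr (- 1 - a) = t powr (- a)" if "0 < t"
      using that by (simp add: powr_mult_base)
    moreover have "(1 - exp (- t)) * t powr (- 1 - a) \<le> 1 * t powr (- 1 - a)"
      by (intro mult_right_mono) auto
    moreover have "0 \<le> (1 - exp (- t)) * t powr (- 1 - a)" if "0 < t" using that by simp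
    moreover have "- 1 \<le> exp (- 1 :: real)" by (rule order_trans[OF _ exp_ge_zero]) simp
    ultimately show ?thesis by (auto simp: indicator_def abs_mult)
  qed
  have "set_integrable lebesgue {0<..1} (\<lambda>t::real. t powr (- a))"
    by (intro nonnegative_absolutely_integrable_1 integrable_on_powr_from_0') (use assms in auto)
  moreover have "set_integrable lebesgue {1..} (\<lambda>t::real. t powr (- 1 - a))"
    using has_integral_powr_to_inf[of "- 1 - a" 1] assms
    by (intro nonnegative_absolutely_integrable_1) (auto simp: integrable_on_def)
  ultimately have 1: "integrable lborel (\<lambda>t. indicator {0<..1} t * t powr (- a))"
      "integrable lborel (\<lambda>t. indicator {1..} t * t powr (- 1 - a))"
    by (simp_all add: set_integrable_def integrable_completion)
  show ?thesis
    by (rule Bochner_Integration.integrable_bound[OF Bochner_Integration.integrable_add[OF 1]])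
       (use bd in \<open>auto simp: abs_le_iff intro: order_trans[OF _ abs_ge_self]\<close>)
qed

text \<open>The substitution of \<open>u * t\<close> for \<open>t\<close> turns the integral for
  \<open>u\<close> into \<open>u powr a\<close> times the one for 1, which is the constant
  \<open>J\<close>.\<close>

lemma powr_eq_bernstein_integral:
  fixes a :: real
  assumes "0 < a" "a < 1"
  obtains J where "0 < J"
    "\<And>u. 0 \<le> u \<Longrightarrow> integrable lborel (\<lambda>t. indicator {0<..} t * ((1 - exp (- t * u)) * t powr (- 1 - a)))"
    "\<And>u. 0 \<le> u \<Longrightarrow> (\<integral>t. indicator {0<..} t * ((1 - exp (- t * u)) * t powr (- 1 - a)) \<partial>lborel) = u powr a * J"
proof -
  let ?g = "\<lambda>t::real. indicator {0<..} t * ((1 - exp (- t)) * t powr (- 1 - a))"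
  let ?h = "\<lambda>u t::real. indicator {0<..} t * ((1 - exp (- t * u)) * t powr (- 1 - a))"
  note int = integrable_bernstein_density[OF assms]
  define J where "J = (\<integral>t. ?g t \<partial>lborel)"
  \<comment> \<open>The summand 0 matches the affine shape of the substitution rules for
    \<open>lborel\<close>.\<close>
  have h: "?h u t = u powr (1 + a) * ?g (0 + u * t)" if "0 < u" for u t
    using that by (auto simp: indicator_def zero_less_mult_iff powr_mult mult.commute simp flip: powr_add)
  have A: "integrable lborel (?h u)" if "0 \<le> u" for u
  proof (cases "u = 0")
    case False
    then have u: "0 < u" using that by simp
    have "integrable lborel (\<lambda>t. ?g (0 + u * t))"
      using lborel_integrable_real_affine[OF int, of u 0] u by simp
    then show ?thesis unfolding h[OF u] by (rule integrable_mult_right)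
  qed simp
  have B: "(\<integral>t. ?h u t \<partial>lborel) = u powr a * J" if "0 \<le> u" for u
  proof (cases "u = 0")
    case False
    then have u: "0 < u" using that by simp
    have "J = u * (\<integral>t. ?g (0 + u * t) \<partial>lborel)"
      using lborel_integral_real_affine[of u ?g 0] u by (simp add: J_def)
    moreover have "(\<integral>t. ?h u t \<partial>lborel) = u powr (1 + a) * (\<integral>t. ?g (0 + u * t) \<partial>lborel)"
      unfolding h[OF u] by simp
    ultimately show ?thesis using u by (simp add: powr_add)
  qed simp
  have "0 < J"
  proof -
    \<comment> \<open>A lower bound for the integrand on the interval from 1 to 2, which has length
      1, so \<open>J\<close> is at least \<open>?k\<close>.\<close>
    let ?k = "(1 - exp (- 1)) * 2 powr (- 1 - a)"
    have "?k * indicator {1..2} t \<le> ?g t" for t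
      by (auto simp: indicator_def intro!: mult_mono powr_mono2')
        (use assms in auto)
    then have "(\<integral>t. ?k * indicator {1..2::real} t \<partial>lborel) \<le> J"
      unfolding J_def by (intro integral_mono int) auto
    moreover have "(\<integral>t. ?k * indicator {1..2::real} t \<partial>lborel) = ?k" by simp
    moreover have "0 < ?k" by simp
    ultimately show ?thesis by linarith
  qed
  with A B show ?thesis using that by blast
qed

text \<open>The integral representation is applied to the squared distance with exponent
  \<open>p / 2\<close>. It requires \<open>p / 2 < 1\<close>, so \<open>p = 2\<close> is treated
  directly.\<close>

lemma cnd_on_powr:
  fixes h :: "'a \<Rightarrow> real"
  assumes fin: "finite S" and p: "0 < p" "p \<le> 2"
  shows "cnd_on S (\<lambda>x y. \<bar>h x - h y\<bar> powr p)"
proof (cases "p = 2")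
  case True
  then show ?thesis using cnd_on_square[of S h] by (simp add: powr_numeral)
next
  case False
  then have "0 < p / 2" "p / 2 < 1" using p by auto
  then obtain J where J: "0 < J" and
    int: "\<And>u. 0 \<le> u \<Longrightarrow> integrable lborel (\<lambda>t. indicator {0<..} t * ((1 - exp (- t * u)) * t powr (- 1 - p / 2)))" and
    eq: "\<And>u. 0 \<le> u \<Longrightarrow> (\<integral>t. indicator {0<..} t * ((1 - exp (- t * u)) * t powr (- 1 - p / 2)) \<partial>lborel) = u powr (p / 2) * J"
    using powr_eq_bernstein_integral by blast
  let ?u = "\<lambda>x y. (h x - h y)\<^sup>2"
  define F where "F = (\<lambda>x y t. indicator {0<..} t * ((1 - exp (- t * ?u x y)) * t powr (- 1 - p / 2)))"
  have u: "?u x y powr (p / 2) = \<bar>h x - h y\<bar> powr p" for x y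
  proof -
    have "?u x y = \<bar>h x - h y\<bar> powr 2" by (simp add: powr_numeral)
    then show ?thesis unfolding \<open>?u x y = _\<close> by (simp only: powr_powr) simp
  qed
  have intF: "integrable lborel (F x y)" for x y
    unfolding F_def by (rule int) simp
  have eqF: "(\<integral>t. F x y t \<partial>lborel) = \<bar>h x - h y\<bar> powr p * J" for x y
    unfolding F_def u[symmetric] by (rule eq) simp
  show ?thesis
    unfolding cnd_on_def
  proof (intro conjI ballI allI impI)
    fix c :: "'a \<Rightarrow> real" assume c0: "sum c S = 0"
    have "(\<Sum>x\<in>S. \<Sum>y\<in>S. c x * c y * \<bar>h x - h y\<bar> powr p) * J
        = (\<Sum>x\<in>S. \<Sum>y\<in>S. c x * c y * (\<integral>t. F x y t \<partial>lborel))"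
      by (simp add: eqF sum_distrib_right mult.assoc)
    also have "\<dots> = (\<integral>t. (\<Sum>x\<in>S. \<Sum>y\<in>S. c x * c y * F x y t) \<partial>lborel)"
      by (simp add: intF Bochner_Integration.integral_sum)
    also have "\<dots> \<le> 0"
    proof -
      have "(\<Sum>x\<in>S. \<Sum>y\<in>S. c x * c y * F x y t) \<le> 0" for t :: real
      proof (cases "0 < t")
        case True
        let ?E = "\<Sum>x\<in>S. \<Sum>y\<in>S. c x * c y * exp (- (t * ?u x y))"
        have "psd_on S (\<lambda>x y. exp (- (t * ?u x y)))"
          using True by (intro psd_on_exp_cnd fin cnd_on_scale cnd_on_square) simp
        then have E: "0 \<le> ?E" by (rule psd_onD)
        \<comment> \<open>The constant 1 in the integrand contributes the square of the sum of the
          weights, which is 0; what remains is minus the form of a Gaussian kernel.\<close>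
        have "(\<Sum>x\<in>S. \<Sum>y\<in>S. c x * c y * F x y t) = ((\<Sum>x\<in>S. \<Sum>y\<in>S. c x * c y) - ?E) * t powr (- 1 - p / 2)"
          unfolding sum_subtractf[symmetric] sum_distrib_right
          by (intro sum.cong refl) (use True in \<open>simp add: F_def algebra_simps\<close>)
        also have "(\<Sum>x\<in>S. \<Sum>y\<in>S. c x * c y) = 0" using c0 by (simp flip: sum_product)
        finally show ?thesis using E by (simp add: mult_nonneg_nonneg)
      qed (simp add: F_def)
      then show ?thesis
        using integral_nonneg_AE[where M = lborel and f = "\<lambda>t. - (\<Sum>x\<in>S. \<Sum>y\<in>S. c x * c y * F x y t)"] by simp
    qed
    finally show "(\<Sum>x\<in>S. \<Sum>y\<in>S. c x * c y * \<bar>h x - h y\<bar> powr p) \<le> 0"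
      using J by (simp add: mult_le_0_iff)
  qed (simp add: abs_minus_commute)
qed

section \<open>Positive definiteness of \<open>f_fun\<close>\<close>

lemma f_fun_pos: "0 < f_fun p x"
  by (simp add: f_fun_def)

lemma f_fun_minus: "f_fun p (- x) = f_fun p x"
  by (simp add: f_fun_def)

lemma c_const_pos: "0 < p \<Longrightarrow> 0 < c_const p"
  by (simp add: c_const_def add_pos_pos)

lemma f_fun_scaled:
  assumes "0 < p" "0 < s"
  shows "f_fun p (x / s) = exp (- ((c_const p / s) powr p * \<bar>x\<bar> powr p))"
proof -
  have "c_const p * \<bar>x / s\<bar> = c_const p / s * \<bar>x\<bar>" using assms by simp
  then show ?thesis using c_const_pos[OF assms(1)] assms(2) by (simp only: f_fun_def powr_mult)
qed

text \<open>Coordinate functions on an arbitrary index set are used so that labelled points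
  coinciding in the plane still receive separate weights.\<close>

lemma psd_on_f_fun2:
  fixes h1 h2 :: "'a \<Rightarrow> real"
  assumes "finite S" "0 < p" "p \<le> 2" "0 < s"
  shows "psd_on S (\<lambda>x y. f_fun p ((h1 x - h1 y) / s) * f_fun p ((h2 x - h2 y) / s))"
proof -
  have "psd_on S (\<lambda>x y. f_fun p ((h x - h y) / s))" for h
    unfolding f_fun_scaled[OF assms(2,4)]
    by (intro psd_on_exp_cnd cnd_on_scale cnd_on_powr assms) simp
  then show ?thesis by (intro psd_on_mult assms)
qed

section \<open>Translates of lattice sums\<close>

text \<open>An averaging argument: in a large box almost every row sum of \<open>G\<close> contains
  a full copy of the sum over \<open>B\<close>, while every row sum of \<open>F\<close> is at most
  the infinite sum. The boundary is negligible as the box grows.\<close>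

lemma sum_le_infsum_of_translates:
  fixes F G :: "int \<times> int \<Rightarrow> real"
  assumes F: "F summable_on UNIV" and F0: "\<And>d. 0 \<le> F d" and G0: "\<And>d. 0 \<le> G d"
    and le: "\<And>S. finite S \<Longrightarrow> (\<Sum>a\<in>S. \<Sum>b\<in>S. G (a - b)) \<le> (\<Sum>a\<in>S. \<Sum>b\<in>S. F (a - b))"
    and B: "finite B"
  shows "sum G B \<le> infsum F UNIV"
proof -
  let ?I = "infsum F UNIV"
  have "\<exists>R. \<forall>i j. (i, j) \<in> B \<longrightarrow> \<bar>i\<bar> \<le> int R \<and> \<bar>j\<bar> \<le> int R"
  proof -
    have "finite ((\<lambda>(i, j). nat (max \<bar>i\<bar> \<bar>j\<bar>)) ` B)" using B by simp
    then obtain R where "\<forall>m \<in> (\<lambda>(i, j). nat (max \<bar>i\<bar> \<bar>j\<bar>)) ` B. m \<le> R"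
      using finite_nat_set_iff_bounded_le by blast
    then have "\<bar>i\<bar> \<le> int R \<and> \<bar>j\<bar> \<le> int R" if "(i, j) \<in> B" for i j using that by fastforce
    then show ?thesis by blast
  qed
  then obtain R :: nat where R: "\<And>i j. (i, j) \<in> B \<Longrightarrow> \<bar>i\<bar> \<le> int R \<and> \<bar>j\<bar> \<le> int R"
    by blast
  define Q where "Q = (\<lambda>N::nat. {- int N..int N} \<times> {- int N..int N})"
  have finQ: "finite (Q N)" for N by (simp add: Q_def)
  have cardQ: "real (card (Q N)) = (2 * real N + 1)\<^sup>2" for N
    by (simp add: Q_def card_cartesian_product power2_eq_square)
  have bound: "(2 * real N + 1)\<^sup>2 * sum G B \<le> (2 * real (N + R) + 1)\<^sup>2 * ?I" for N
  proof -
    \<comment> \<open>Enlarging the box by the radius \<open>R\<close> of \<open>B\<close> makes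
      room for the translate of \<open>B\<close> by any \<open>b\<close> in the smaller box.\<close>
    have inner: "sum G B \<le> (\<Sum>a\<in>Q (N + R). G (a - b))" if "b \<in> Q N" for b
    proof -
      have "sum G B = (\<Sum>a\<in>(\<lambda>d. d + b) ` B. G (a - b))"
        by (subst sum.reindex) (auto simp: inj_on_def)
      also have "\<dots> \<le> (\<Sum>a\<in>Q (N + R). G (a - b))"
      proof (rule sum_mono2)
        show "(\<lambda>d. d + b) ` B \<subseteq> Q (N + R)"
        proof
          fix e assume "e \<in> (\<lambda>d. d + b) ` B"
          then obtain i j where "(i, j) \<in> B" "e = (i, j) + b" by auto
          then show "e \<in> Q (N + R)" using R[of i j] that by (cases b) (auto simp: Q_def)
        qed
      qed (auto simp: finQ G0)
      finally show ?thesis .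
    qed
    have "(2 * real N + 1)\<^sup>2 * sum G B = (\<Sum>b\<in>Q N. sum G B)" by (simp add: cardQ)
    also have "\<dots> \<le> (\<Sum>b\<in>Q N. \<Sum>a\<in>Q (N + R). G (a - b))" by (intro sum_mono inner)
    \<comment> \<open>Both indices must run over the same box before \<open>le\<close>
      applies.\<close>
    also have "\<dots> \<le> (\<Sum>b\<in>Q (N + R). \<Sum>a\<in>Q (N + R). G (a - b))"
      by (rule sum_mono2) (auto simp: Q_def intro!: sum_nonneg G0)
    also have "\<dots> = (\<Sum>a\<in>Q (N + R). \<Sum>b\<in>Q (N + R). G (a - b))" by (rule sum.swap)
    also have "\<dots> \<le> (\<Sum>a\<in>Q (N + R). \<Sum>b\<in>Q (N + R). F (a - b))" by (rule le[OF finQ])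
    also have "\<dots> \<le> (\<Sum>a\<in>Q (N + R). ?I)"
    proof (rule sum_mono)
      fix a assume "a \<in> Q (N + R)"
      have "(\<Sum>b\<in>Q (N + R). F (a - b)) = sum F ((\<lambda>b. a - b) ` Q (N + R))"
        by (subst sum.reindex) (auto simp: inj_on_def)
      also have "\<dots> \<le> ?I" by (rule finite_sum_le_infsum[OF F]) (auto simp: finQ F0)
      finally show "(\<Sum>b\<in>Q (N + R). F (a - b)) \<le> ?I" .
    qed
    also have "\<dots> = (2 * real (N + R) + 1)\<^sup>2 * ?I" by (simp add: cardQ)
    finally show ?thesis .
  qed
  have "(\<lambda>N. (1 + 2 * real R / (2 * real N + 1))\<^sup>2 * ?I) \<longlonglongrightarrow> (1 + 0)\<^sup>2 * ?I"
  proof (intro tendsto_intros)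
    have "filterlim (\<lambda>N. 2 * real N + 1) at_top sequentially"
      by (rule filterlim_at_top_mono[OF filterlim_real_sequentially]) simp
    then show "(\<lambda>N. 2 * real R / (2 * real N + 1)) \<longlonglongrightarrow> 0"
      by (intro tendsto_divide_0[OF tendsto_const] filterlim_at_top_imp_at_infinity)
  qed
  moreover have "sum G B \<le> (1 + 2 * real R / (2 * real N + 1))\<^sup>2 * ?I" for N
  proof -
    have "1 + 2 * real R / (2 * real N + 1) = (2 * real (N + R) + 1) / (2 * real N + 1)"
      by (simp add: field_simps)
    then show ?thesis using bound[of N] by (simp add: power_divide field_simps)
  qed
  ultimately show ?thesis by (auto intro!: LIMSEQ_le_const)
qed

text \<open>The left side is a finite partial sum, so the bound also yields summability over
  translates instead of presupposing it.\<close>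

lemma shifted_lattice_sum_le:
  fixes v q :: real
  assumes p: "0 < p" "p \<le> 2" and s: "0 < s"
    and F: "(\<lambda>(i, j). f_fun p (of_int i / s) * f_fun p ((of_int i + q * of_int j) / s)) summable_on (UNIV :: (int \<times> int) set)"
    and B: "finite B"
  shows "(\<Sum>(i, j)\<in>B. f_fun p ((v + of_int i) / s) * f_fun p ((v + of_int i + q * of_int j) / s))
    \<le> (\<Sum>\<^sub>\<infinity>(i, j). f_fun p (of_int i / s) * f_fun p ((of_int i + q * of_int j) / s))"
proof -
  define \<phi> where "\<phi> = (\<lambda>x y. f_fun p (x / s) * f_fun p (y / s))"
  define H where "H = (\<lambda>w (i, j). \<phi> (w + of_int i) (w + of_int i + q * of_int j) :: real)"
  have \<phi>: "\<phi> (- x) (- y) = \<phi> x y" for x y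
    using f_fun_minus[of p "x / s"] f_fun_minus[of p "y / s"] by (simp add: \<phi>_def)
  have "sum (H v) B \<le> infsum (H 0) UNIV"
  proof (rule sum_le_infsum_of_translates[OF _ _ _ _ B])
    show "H 0 summable_on UNIV" using F by (simp add: H_def \<phi>_def)
    show "0 \<le> H 0 d" "0 \<le> H v d" for d
      by (auto simp: H_def \<phi>_def case_prod_beta less_imp_le[OF f_fun_pos])
    fix S :: "(int \<times> int) set" assume S: "finite S"
    \<comment> \<open>The label \<open>b\<close> tells a lattice point (\<open>False\<close>) from
      its translate by \<open>(v, v)\<close> (\<open>True\<close>).\<close>
    define h1 where "h1 = (\<lambda>((i::int, j::int), b). of_int i + (if b then v else 0))"
    define h2 where "h2 = (\<lambda>((i::int, j::int), b). of_int i + q * of_int j + (if b then v else 0))"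
    define c where "c = (\<lambda>(d :: int \<times> int, b). if b then 1 else - 1 :: real)"
    let ?K = "\<lambda>x y. \<phi> (h1 x - h1 y) (h2 x - h2 y)"
    have "psd_on (S \<times> UNIV) ?K"
      unfolding \<phi>_def by (intro psd_on_f_fun2 p s) (simp add: S)
    then have "0 \<le> (\<Sum>x\<in>S \<times> UNIV. \<Sum>y\<in>S \<times> UNIV. c x * c y * ?K x y)"
      by (rule psd_onD)
    also have "\<dots> = (\<Sum>a\<in>S. \<Sum>b\<in>UNIV. \<Sum>a'\<in>S. \<Sum>b'\<in>UNIV. c (a, b) * c (a', b') * ?K (a, b) (a', b'))"
      by (simp add: sum.cartesian_product')
    \<comment> \<open>Equal labels give \<open>H 0\<close> twice with sign plus; the two mixed pairs
      give the shifts by \<open>v\<close> and \<open>- v\<close> with sign minus.\<close>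
    also have "\<dots> = (\<Sum>a\<in>S. \<Sum>a'\<in>S. 2 * H 0 (a - a') - H v (a - a') - H (- v) (a - a'))"
      by (simp add: UNIV_bool flip: sum.distrib)
         (intro sum.cong refl, auto simp: c_def h1_def h2_def H_def algebra_simps)
    also have "\<dots> = 2 * (\<Sum>a\<in>S. \<Sum>b\<in>S. H 0 (a - b)) - (\<Sum>a\<in>S. \<Sum>b\<in>S. H v (a - b)) - (\<Sum>a\<in>S. \<Sum>b\<in>S. H (- v) (a - b))"
      by (simp add: sum_subtractf sum_distrib_left)
    also have "(\<Sum>a\<in>S. \<Sum>b\<in>S. H (- v) (a - b)) = (\<Sum>a\<in>S. \<Sum>b\<in>S. H v (a - b))"
    proof -
      have "H (- v) (a - b) = H v (b - a)" for a b
        using \<phi>[of "v + of_int (fst b - fst a)" "v + of_int (fst b - fst a) + q * of_int (snd b - snd a)"]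
        by (simp add: H_def case_prod_beta algebra_simps)
      then show ?thesis by (subst sum.swap) simp
    qed
    finally show "(\<Sum>a\<in>S. \<Sum>b\<in>S. H v (a - b)) \<le> (\<Sum>a\<in>S. \<Sum>b\<in>S. H 0 (a - b))" by simp
  qed
  then show ?thesis by (simp add: H_def \<phi>_def case_prod_beta)
qed

text \<open>The triple \<open>(z, a, b)\<close> describes each point repeatedly;
  \<open>i = z + q * a\<close> and \<open>j = b - a\<close> are coordinates that become injective
  for \<open>q > 0\<close>, as reindexing of the infinite sum requires.\<close>

lemma L_lattice_eq_range:
  "L_lattice q = range (\<lambda>(i :: int, j :: int). (of_int i, of_int i + real q * of_int j))"
proof (intro equalityI subsetI)
  fix P assume "P \<in> L_lattice q"
  then obtain z a b :: int where P: "P = (of_int z + real q * of_int a, of_int z + real q * of_int b)"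
    by (auto simp: L_lattice_def)
  then have "P = (\<lambda>(i :: int, j :: int). (of_int i, of_int i + real q * of_int j)) (z + int q * a, b - a)"
    by (simp add: algebra_simps)
  then show "P \<in> range (\<lambda>(i :: int, j :: int). (of_int i, of_int i + real q * of_int j))" by blast
next
  fix P :: "real \<times> real" assume "P \<in> range (\<lambda>(i :: int, j :: int). (of_int i, of_int i + real q * of_int j))"
  then obtain i j :: int where "P = (of_int i + real q * of_int 0, of_int i + real q * of_int j)" by auto
  then show "P \<in> L_lattice q" unfolding L_lattice_def by blast
qed

lemma
  assumes "0 < q"
  shows f_sum2_L_lattice: "f_sum2 p s (L_lattice q) =
      (\<Sum>\<^sub>\<infinity>(i :: int, j :: int). f_fun p (of_int i / s) * f_fun p ((of_int i + real q * of_int j) / s))"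
    and summable_L_lattice: "f_sum2 p s (L_lattice q) \<noteq> 0 \<Longrightarrow>
      (\<lambda>(i :: int, j :: int). f_fun p (of_int i / s) * f_fun p ((of_int i + real q * of_int j) / s)) summable_on UNIV"
proof -
  let ?e = "\<lambda>(i :: int, j :: int). (of_int i :: real, of_int i + real q * of_int j)"
  have inj: "inj ?e" using assms by (auto simp: inj_on_def)
  show *: "f_sum2 p s (L_lattice q) =
      (\<Sum>\<^sub>\<infinity>(i :: int, j :: int). f_fun p (of_int i / s) * f_fun p ((of_int i + real q * of_int j) / s))"
    unfolding f_sum2_def L_lattice_eq_range infsum_reindex[OF inj] by (simp add: o_def case_prod_unfold)
  show "(\<lambda>(i :: int, j :: int). f_fun p (of_int i / s) * f_fun p ((of_int i + real q * of_int j) / s)) summable_on UNIV"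
    if "f_sum2 p s (L_lattice q) \<noteq> 0"
    using that infsum_not_exists unfolding * by blast
qed

section \<open>Correlation with the weight vector\<close>

definition coset_weight :: "real \<Rightarrow> real \<Rightarrow> nat \<Rightarrow> real \<Rightarrow> real" where
  "coset_weight p s q v = f_sum p s {v + real q * of_int z | z :: int. True}"

lemma coset_weight_eq_infsum:
  assumes "0 < q"
  shows "coset_weight p s q v = (\<Sum>\<^sub>\<infinity>z::int. f_fun p ((v + real q * of_int z) / s))"
proof -
  have inj: "inj (\<lambda>z::int. v + real q * of_int z)" using assms by (auto simp: inj_on_def)
  have "{v + real q * of_int z | z :: int. True} = range (\<lambda>z::int. v + real q * of_int z)" by auto
  then show ?thesis
    unfolding coset_weight_def f_sum_def by (simp add: infsum_reindex[OF inj] o_def)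
qed

lemma weights_eq:
  "weights p s q ys = concat (map (\<lambda>y. map (\<lambda>x. coset_weight p s q (y - real x)) [0..<q]) ys)"
  by (simp add: weights_def coset_weight_def)

context
  fixes p s :: real and q :: nat
  assumes p: "0 < p" "p \<le> 2" and s: "0 < s" and q: "0 < q"
    and nz: "f_sum2 p s (L_lattice q) \<noteq> 0"
begin

text \<open>Expanding the squares gives products of \<open>f_fun\<close> at
  \<open>y - x + q * z\<close> and \<open>y - x + q * z'\<close>. These pairs are distinct points of
  the lattice translated by \<open>(y, y)\<close>, with coordinates given by
  \<open>?m\<close>.\<close>

lemma sum_coset_squares_le:
  fixes Z :: "int set"
  assumes "finite Z"
  shows "(\<Sum>x<q. (\<Sum>z\<in>Z. f_fun p ((y - real x + real q * of_int z) / s))\<^sup>2) \<le> f_sum2 p s (L_lattice q)"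
proof -
  let ?g = "\<lambda>x z. f_fun p ((y - real x + real q * of_int z) / s)"
  let ?G = "\<lambda>(i::int, j::int). f_fun p ((y + of_int i) / s) * f_fun p ((y + of_int i + real q * of_int j) / s)"
  let ?m = "\<lambda>(x::nat, z, z'). (int q * z - int x, z' - z)"
  have inj: "inj_on ?m ({..<q} \<times> Z \<times> Z)"
  proof (rule inj_onI)
    fix P P' assume P: "P \<in> {..<q} \<times> Z \<times> Z" "P' \<in> {..<q} \<times> Z \<times> Z" and eq: "?m P = ?m P'"
    obtain x z w x' z' w' where [simp]: "P = (x, z, w)" "P' = (x', z', w')" by (metis prod_cases3)
    have e: "int q * z - int x = int q * z' - int x'" "w - z = w' - z'" using eq by auto
    \<comment> \<open>Two residues below \<open>q\<close> cannot differ by a nonzero multiple of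
      \<open>q\<close>.\<close>
    have "int x - int x' = int q * (z - z')" using e(1) by (simp add: algebra_simps)
    moreover have "\<bar>int x - int x'\<bar> < int q" using P by auto
    ultimately have "z = z'" using q by (simp add: abs_mult)
    then show "P = P'" using e by simp
  qed
  have "(\<Sum>x<q. (\<Sum>z\<in>Z. ?g x z)\<^sup>2) = (\<Sum>x<q. \<Sum>z\<in>Z. \<Sum>z'\<in>Z. ?g x z * ?g x z')"
    by (simp add: power2_eq_square sum_product)
  also have "\<dots> = (\<Sum>P\<in>{..<q} \<times> Z \<times> Z. ?G (?m P))"
    by (simp add: sum.cartesian_product' case_prod_beta algebra_simps)
  also have "\<dots> = sum ?G (?m ` ({..<q} \<times> Z \<times> Z))"
    by (simp add: sum.reindex[OF inj])
  also have "\<dots> \<le> f_sum2 p s (L_lattice q)"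
    unfolding f_sum2_L_lattice[OF q] using assms
    by (intro shifted_lattice_sum_le p s summable_L_lattice q nz) auto
  finally show ?thesis .
qed

lemma coset_summable: "(\<lambda>z::int. f_fun p ((v + real q * of_int z) / s)) summable_on UNIV"
proof (rule nonneg_bdd_above_summable_on)
  show "bdd_above (sum (\<lambda>z::int. f_fun p ((v + real q * of_int z) / s)) ` {Z. Z \<subseteq> UNIV \<and> finite Z})"
  proof (rule bdd_aboveI2)
    fix Z :: "int set" assume "Z \<in> {Z. Z \<subseteq> UNIV \<and> finite Z}"
    then have Z: "finite Z" by simp
    \<comment> \<open>One coset sum is the term \<open>x = 0\<close> of the preceding bound with
      \<open>y = v\<close>.\<close>
    have "(\<Sum>z\<in>Z. f_fun p ((v + real q * of_int z) / s))\<^sup>2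
        = (\<Sum>x\<in>{0}. (\<Sum>z\<in>Z. f_fun p ((v - real x + real q * of_int z) / s))\<^sup>2)" by simp
    also have "\<dots> \<le> (\<Sum>x<q. (\<Sum>z\<in>Z. f_fun p ((v - real x + real q * of_int z) / s))\<^sup>2)"
      by (rule sum_mono2) (use q in auto)
    also have "\<dots> \<le> f_sum2 p s (L_lattice q)" by (rule sum_coset_squares_le[OF Z])
    finally show "(\<Sum>z\<in>Z. f_fun p ((v + real q * of_int z) / s)) \<le> sqrt (f_sum2 p s (L_lattice q))"
      by (rule real_le_rsqrt)
  qed
qed (simp add: less_imp_le[OF f_fun_pos])

text \<open>The bound for finite \<open>Z\<close> is uniform, so it survives the limit along finite
  subsets, taken simultaneously in all \<open>q\<close> cosets.\<close>

lemma sum_coset_weight_squares_le: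
  "(\<Sum>x<q. (coset_weight p s q (y - real x))\<^sup>2) \<le> f_sum2 p s (L_lattice q)"
proof (rule tendsto_upperbound)
  show "((\<lambda>Z. \<Sum>x<q. (\<Sum>z\<in>Z. f_fun p ((y - real x + real q * of_int z) / s))\<^sup>2)
      \<longlongrightarrow> (\<Sum>x<q. (coset_weight p s q (y - real x))\<^sup>2)) (finite_subsets_at_top UNIV)"
    unfolding coset_weight_eq_infsum[OF q]
    by (intro tendsto_sum tendsto_power infsum_tendsto coset_summable)
  show "\<forall>\<^sub>F Z in finite_subsets_at_top UNIV.
      (\<Sum>x<q. (\<Sum>z\<in>Z. f_fun p ((y - real x + real q * of_int z) / s))\<^sup>2) \<le> f_sum2 p s (L_lattice q)"
    by (rule eventually_finite_subsets_at_top_weakI) (rule sum_coset_squares_le)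
qed simp

lemma f_fun_centered_le_coset_weight: "f_fun p (centered q v / s) \<le> coset_weight p s q v"
proof -
  define z where "z = - \<lfloor>v / real q + 1 / 2\<rfloor>"
  have "centered q v = v + real q * of_int z" by (simp add: centered_def z_def)
  then have "f_fun p (centered q v / s) = (\<Sum>z\<in>{z}. f_fun p ((v + real q * of_int z) / s))" by simp
  also have "\<dots> \<le> coset_weight p s q v"
    unfolding coset_weight_eq_infsum[OF q]
    by (rule finite_sum_le_infsum[OF coset_summable]) (auto simp: less_imp_le[OF f_fun_pos])
  finally show ?thesis .
qed

section \<open>Norm of the weight vector and inner product with a codeword\<close>

lemma l2_norm_weights:
  "(l2_norm (weights p s q ys))\<^sup>2 = (\<Sum>y\<leftarrow>ys. \<Sum>x<q. (coset_weight p s q (y - real x))\<^sup>2)"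
proof -
  have "(\<Sum>w\<leftarrow>weights p s q ys. w\<^sup>2) = (\<Sum>y\<leftarrow>ys. \<Sum>x<q. (coset_weight p s q (y - real x))\<^sup>2)"
    by (induction ys)
       (simp_all add: weights_eq o_def interv_sum_list_conv_sum_set_nat atLeast0LessThan)
  moreover have "0 \<le> (\<Sum>w\<leftarrow>weights p s q ys. w\<^sup>2)" by (rule sum_list_nonneg) auto
  ultimately show ?thesis by (simp add: l2_norm_def)
qed

lemma l2_norm_weights_le:
  "(l2_norm (weights p s q ys))\<^sup>2 \<le> real (length ys) * f_sum2 p s (L_lattice q)"
  unfolding l2_norm_weights
  by (induction ys) (auto simp: algebra_simps intro: add_mono sum_coset_weight_squares_le)

text \<open>A zero norm would make \<open>corr\<close> equal to 0 by the convention on division, so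
  positivity must precede any bound on the quotient.\<close>

lemma l2_norm_weights_pos:
  assumes "ys \<noteq> []"
  shows "0 < l2_norm (weights p s q ys)"
proof -
  have pos: "0 < (\<Sum>x<q. (coset_weight p s q (y - real x))\<^sup>2)" for y
  proof (rule sum_pos)
    fix x
    have "0 < coset_weight p s q (y - real x)"
      by (rule less_le_trans[OF f_fun_pos f_fun_centered_le_coset_weight])
    then show "0 < (coset_weight p s q (y - real x))\<^sup>2" by simp
  qed (use q in auto)
  have "0 < (\<Sum>y\<leftarrow>ys. \<Sum>x<q. (coset_weight p s q (y - real x))\<^sup>2)"
    using assms by (induction ys rule: list_nonempty_induct) (auto simp: pos intro: add_pos_pos)
  then have "l2_norm (weights p s q ys) \<noteq> 0" using l2_norm_weights[of ys] by auto
  moreover have "0 \<le> l2_norm (weights p s q ys)"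
    unfolding l2_norm_def by (intro real_sqrt_ge_zero sum_list_nonneg) auto
  ultimately show ?thesis by simp
qed

lemma inner_list_append:
  "length u = length v \<Longrightarrow> inner_list (u @ u') (v @ v') = inner_list u v + inner_list u' v'"
  by (simp add: inner_list_def)

lemma inner_weights_indicator:
  assumes "length ys = length c" "set c \<subseteq> {..<q}"
  shows "inner_list (weights p s q ys) (indicator_vec q c)
    = (\<Sum>(y, a)\<leftarrow>zip ys c. coset_weight p s q (y - real a))"
  using assms
proof (induction ys c rule: list_induct2)
  case Nil
  then show ?case by (simp add: inner_list_def weights_def indicator_vec_def)
next
  case (Cons y ys a c)
  have "inner_list (map (\<lambda>x. coset_weight p s q (y - real x)) [0..<q]) (map (\<lambda>x. if x = a then 1 else 0) [0..<q])
      = (\<Sum>x\<in>{0..<q}. if x = a then coset_weight p s q (y - real x) else 0)"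
    by (simp add: inner_list_def zip_map_map zip_same_conv_map o_def interv_sum_list_conv_sum_set_nat
        if_distrib[of "\<lambda>z. _ * z"] cong: if_cong)
  also have "\<dots> = coset_weight p s q (y - real a)" using Cons.prems by simp
  finally show ?case
    using Cons by (simp add: weights_eq indicator_vec_def inner_list_append)
qed

text \<open>Each weight is at least the tangent line of \<open>exp (- u)\<close> at
  \<open>u = \<mu>\<close>, the exponent belonging to distance \<open>\<delta>\<close>. The distance
  bound says that the exponents average to at most \<open>\<mu>\<close>, so the tangent lines
  average to at least \<open>exp (- \<mu>)\<close>.\<close>

lemma sum_coset_weight_ge:
  assumes len: "length ys = length c" and \<delta>: "0 \<le> \<delta>"
    and dist: "lp_dist p q ys c \<le> \<delta> * real (length c) powr (1 / p)"
  shows "real (length c) * f_fun p (\<delta> / s) \<le> (\<Sum>(y, a)\<leftarrow>zip ys c. coset_weight p s q (y - real a))"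
proof -
  define \<kappa> where "\<kappa> = (c_const p / s) powr p"
  define \<mu> where "\<mu> = \<kappa> * \<delta> powr p"
  define d where "d = (\<Sum>(y, a)\<leftarrow>zip ys c. \<bar>centered q (y - real a)\<bar> powr p)"
  have \<kappa>: "0 \<le> \<kappa>" by (simp add: \<kappa>_def)
  have f: "f_fun p (x / s) = exp (- (\<kappa> * \<bar>x\<bar> powr p))" for x
    using f_fun_scaled[OF p(1) s] by (simp add: \<kappa>_def)
  have d0: "0 \<le> d" unfolding d_def by (intro sum_list_nonneg) auto
  have "lp_dist p q ys c = d powr (1 / p)"
    by (simp add: lp_dist_def lp_norm_def d_def o_def case_prod_unfold)
  then have "(d powr (1 / p)) powr p \<le> (\<delta> * real (length c) powr (1 / p)) powr p"
    using dist p by (intro powr_mono2) auto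
  then have d: "d \<le> \<delta> powr p * real (length c)"
    using p \<delta> d0 by (simp add: powr_powr powr_mult)
  have tangent: "exp (- \<mu>) * (1 + \<mu> - \<kappa> * \<bar>centered q v\<bar> powr p) \<le> coset_weight p s q v" for v
  proof -
    let ?u = "\<kappa> * \<bar>centered q v\<bar> powr p"
    have "exp (- \<mu>) * (1 + (\<mu> - ?u)) \<le> exp (- \<mu>) * exp (\<mu> - ?u)"
      by (intro mult_left_mono exp_ge_add_one_self) simp
    also have "\<dots> = f_fun p (centered q v / s)" by (simp add: f flip: exp_add)
    also note f_fun_centered_le_coset_weight
    finally show ?thesis by (simp only: add_diff_eq)
  qed
  have "real (length c) \<le> (1 + \<mu>) * real (length c) - \<kappa> * d"
    using mult_left_mono[OF d \<kappa>] by (simp add: \<mu>_def algebra_simps)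
  then have "exp (- \<mu>) * real (length c) \<le> exp (- \<mu>) * ((1 + \<mu>) * real (length c) - \<kappa> * d)"
    by (rule mult_left_mono) simp
  also have "\<dots> \<le> (\<Sum>(y, a)\<leftarrow>zip ys c. coset_weight p s q (y - real a))"
    unfolding d_def using len
  proof (induction ys c rule: list_induct2)
    case (Cons y ys a c)
    then show ?case using tangent[of "y - real a"] by (simp add: algebra_simps)
  qed simp
  finally show ?thesis using \<delta> by (simp add: f \<mu>_def mult.commute)
qed

text \<open>The numerator is at least \<open>n * f_fun p (\<delta> / s)\<close> and the denominator
  at most \<open>n\<close> times the root of the lattice sum; the factor \<open>n\<close>
  cancels.\<close>

lemma W_bound_le_corr:
  assumes len: "length ys = length c" and c: "set c \<subseteq> {..<q}" "c \<noteq> []" and \<delta>: "0 \<le> \<delta>"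
    and dist: "lp_dist p q ys c \<le> \<delta> * real (length c) powr (1 / p)"
  shows "W_bound p q \<delta> s \<le> corr q (weights p s q ys) c"
proof -
  let ?n = "real (length c)" and ?S = "f_sum2 p s (L_lattice q)" and ?l = "l2_norm (weights p s q ys)"
  have n: "0 < ?n" using c by simp
  have ys: "ys \<noteq> []" using len c by auto
  have l: "0 < ?l" by (rule l2_norm_weights_pos[OF ys])
  have "0 < ?l\<^sup>2" using l by simp
  then have S: "0 < ?S" using l2_norm_weights_le[of ys] len n by (smt (verit) mult_le_0_iff)
  have "?l \<le> sqrt (?n * ?S)" using l2_norm_weights_le[of ys] len by (simp add: real_le_rsqrt)
  then have "?l * sqrt ?n \<le> sqrt (?n * ?S) * sqrt ?n" by (rule mult_right_mono) simp
  also have "\<dots> = (sqrt ?n * sqrt ?n) * sqrt ?S" by (simp only: real_sqrt_mult mult_ac)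
  finally have le: "?l * sqrt ?n \<le> ?n * sqrt ?S" by simp
  have "W_bound p q \<delta> s = ?n * f_fun p (\<delta> / s) / (?n * sqrt ?S)"
    using n by (simp add: W_bound_def)
  also have "\<dots> \<le> ?n * f_fun p (\<delta> / s) / (?l * sqrt ?n)"
    using le l n S by (intro divide_left_mono mult_pos_pos mult_nonneg_nonneg less_imp_le[OF f_fun_pos]) auto
  also have "\<dots> \<le> corr q (weights p s q ys) c"
    unfolding corr_def inner_weights_indicator[OF len c(1)]
    using l n by (intro divide_right_mono sum_coset_weight_ge[OF len \<delta> dist]) auto
  finally show ?thesis .
qed

end

section \<open>The decoding guarantee\<close>

lemma GRS_word:
  assumes "GRS_params q n k \<alpha> t" "c \<in> GRS q k \<alpha> t"
  shows "length c = n" "set c \<subseteq> {..<q}"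
proof -
  have "0 < q" "length \<alpha> = n" "length t = n"
    using assms(1) by (simp_all add: GRS_params_def)
  moreover obtain g where c: "c = map2 (\<lambda>b a. (b * poly g a) mod q) t \<alpha>"
    using assms(2) unfolding GRS_def by blast
  ultimately show "length c = n" "set c \<subseteq> {..<q}" unfolding c by auto
qed

lemma length_weights: "length (weights p s q ys) = q * length ys"
  by (induction ys) (simp_all add: weights_def)

lemma weights_nonneg: "w \<in> set (weights p s q ys) \<Longrightarrow> 0 \<le> w"
  by (auto simp: weights_def f_sum_def intro!: infsum_nonneg less_imp_le[OF f_fun_pos])

text \<open>\<open>C\<close> and \<open>e\<close> are chosen before all parameters, so the running
  time is uniform in them; the tolerance is chosen before the received word.\<close>

theorem theorem4p1:
  fixes GS :: "(GS_input, 's, nat list list) algorithm"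
  assumes "GS_soft_decoder GS"
  shows "\<exists>(C::real) (e::nat). \<forall>(p::real) (\<delta>::real) (s::real) q n k \<alpha> t.
    0 < p \<and> p \<le> 2 \<and> 0 \<le> \<delta> \<and> prime q \<and> 0 < s \<and> GRS_params q n k \<alpha> t \<and>
    adjusted_rate n k < (W_bound p q \<delta> s)\<^sup>2 \<longrightarrow>
    (\<exists>\<tau>>0. \<forall>y. length y = n \<longrightarrow>
      (\<exists>out m. runs GS (q, k, \<alpha>, t, weights p s q y, \<tau>) out m \<and>
         {c \<in> GRS q k \<alpha> t. lp_dist p q y c \<le> \<delta> * real n powr (1 / p)} \<subseteq> set out \<and>
         real m \<le> C * (real n + real q + 1 / (W_bound p q \<delta> s - sqrt (adjusted_rate n k))) ^ e))"
proof -
  obtain C :: real and e :: nat where GS: "\<forall>q n k \<alpha> t w \<tau>.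
        GRS_params q n k \<alpha> t \<and> length w = q * n \<and> (\<forall>x\<in>set w. 0 \<le> x) \<and> 0 < \<tau> \<longrightarrow>
        (\<exists>out m. runs GS (q, k, \<alpha>, t, w, \<tau>) out m \<and>
           set out = {c \<in> GRS q k \<alpha> t. corr q w c \<ge> sqrt (adjusted_rate n k) + \<tau>} \<and>
           real m \<le> C * (real n + real q + 1 / \<tau>) ^ e)"
    using assms unfolding GS_soft_decoder_def by blast
  show ?thesis
  \<comment> \<open>With \<open>\<tau>\<close> equal to the gap, \<open>1 / \<tau>\<close> is the
    quantity in the claimed bound, so the constants of the decoder carry over unchanged.\<close>
  proof (rule exI[of _ C], rule exI[of _ e], intro allI impI, elim conjE)
    fix p \<delta> s :: real and q n k :: nat and \<alpha> t
    assume p: "0 < p" "p \<le> 2" and \<delta>: "0 \<le> \<delta>" and "prime q" and s: "0 < s"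
      and par: "GRS_params q n k \<alpha> t" and rate: "adjusted_rate n k < (W_bound p q \<delta> s)\<^sup>2"
    let ?R = "adjusted_rate n k" and ?W = "W_bound p q \<delta> s"
    have q: "0 < q" and n: "1 \<le> n" and "1 \<le> k" using par by (auto simp: GRS_params_def)
    then have R: "0 \<le> ?R" by (simp add: adjusted_rate_def)
    \<comment> \<open>A zero lattice sum would give \<open>W_bound p q \<delta> s = 0\<close>, while
      its square exceeds a nonnegative rate.\<close>
    have nz: "f_sum2 p s (L_lattice q) \<noteq> 0" using rate R by (auto simp: W_bound_def)
    have "0 \<le> f_sum2 p s (L_lattice q)"
      unfolding f_sum2_def by (rule infsum_nonneg) (auto simp: less_imp_le[OF f_fun_pos])
    then have "0 \<le> ?W" by (simp add: W_bound_def less_imp_le[OF f_fun_pos])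
    then have \<tau>: "0 < ?W - sqrt ?R" using real_sqrt_less_mono[OF rate] by simp
    show "\<exists>\<tau>>0. \<forall>y. length y = n \<longrightarrow>
      (\<exists>out m. runs GS (q, k, \<alpha>, t, weights p s q y, \<tau>) out m \<and>
         {c \<in> GRS q k \<alpha> t. lp_dist p q y c \<le> \<delta> * real n powr (1 / p)} \<subseteq> set out \<and>
         real m \<le> C * (real n + real q + 1 / (?W - sqrt ?R)) ^ e)"
    proof (intro exI[of _ "?W - sqrt ?R"] conjI \<tau> allI impI)
      fix y :: "real list" assume y: "length y = n"
      have "length (weights p s q y) = q * n" "\<forall>x\<in>set (weights p s q y). 0 \<le> x"
        by (simp_all add: length_weights y weights_nonneg)
      with GS[rule_format, of q n k \<alpha> t "weights p s q y" "?W - sqrt ?R"] par \<tau>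
      obtain out m where run: "runs GS (q, k, \<alpha>, t, weights p s q y, ?W - sqrt ?R) out m"
        and out: "set out = {c \<in> GRS q k \<alpha> t. corr q (weights p s q y) c \<ge> sqrt ?R + (?W - sqrt ?R)}"
        and m: "real m \<le> C * (real n + real q + 1 / (?W - sqrt ?R)) ^ e"
        by blast
      have "{c \<in> GRS q k \<alpha> t. lp_dist p q y c \<le> \<delta> * real n powr (1 / p)} \<subseteq> set out"
      proof clarify
        fix c assume c: "c \<in> GRS q k \<alpha> t" and dist: "lp_dist p q y c \<le> \<delta> * real n powr (1 / p)"
        have len: "length c = n" and cq: "set c \<subseteq> {..<q}" using GRS_word[OF par c] by auto
        have "?W \<le> corr q (weights p s q y) c"
          by (rule W_bound_le_corr[OF p s q nz _ cq _ \<delta>]) (use len y n dist in auto)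
        then show "c \<in> set out" using c by (simp add: out)
      qed
      then show "\<exists>out m. runs GS (q, k, \<alpha>, t, weights p s q y, ?W - sqrt ?R) out m \<and>
         {c \<in> GRS q k \<alpha> t. lp_dist p q y c \<le> \<delta> * real n powr (1 / p)} \<subseteq> set out \<and>
         real m \<le> C * (real n + real q + 1 / (?W - sqrt ?R)) ^ e"
        using run m by blast
    qed
  qed
qed

end
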